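(* For all integers $n\ge 1$ and $r$ with $1\le r\le n+1$, $$N(n,r)\le M(n,r)\,H_{\binom{n+1}{r}}\le M(n,r)\left(1+\log\binom{n+1}{r}\right),$$ where $H_q=1+\frac12+\cdots+\frac1q$.
   Context: $B_n=2^{[n]}$ is the Boolean lattice of all subsets of $[n]=\{1,\dots,n\}$ ordered by inclusion. A chain is a set of pairwise comparable elements; a chain $C$ covers a chain $D$ if $D\subseteq C$. For $1\le r\le n+1$, $N(n,r)$ is the least number of chains in $B_n$ such that every strict chain $F_1\subset F_2\subset\cdots\subset F_r$ of size $r$ in $B_n$ is covered by at least one of them. Let $\mathcal A_{n,r}$ be the set of integer vectors $(a_0,a_1,\dots,a_r)$ with $a_0,a_r\ge 0$, $a_i\ge 1$ for $1\le i\le r-1$, and $a_0+\cdots+a_r=n$. Define $M(n,r)=\max_{(a_0,\dots,a_r)\in\mathcal A_{n,r}}\binom{n}{a_0,a_1,\dots,a_r}$, where $\binom{n}{a_0,\dots,a_r}=\frac{n!}{a_0!\cdots a_r!}$. Here $\log$ is the natural logarithm. *)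

theory Defs
  imports "HOL-Analysis.Harmonic_Numbers"
begin

definition chain_in_Bn :: "nat \<Rightarrow> nat set set \<Rightarrow> bool" where
  "chain_in_Bn n C \<longleftrightarrow> C \<subseteq> Pow {1..n} \<and> chain_subset C"

(* A strict chain F_1 < ... < F_r is identified with the r-element set {F_1, ..., F_r}. *)
definition covers_chains :: "nat \<Rightarrow> nat \<Rightarrow> nat set set set \<Rightarrow> bool" where
  "covers_chains n r \<C> \<longleftrightarrow>
     (\<forall>D. chain_in_Bn n D \<and> card D = r \<longrightarrow> (\<exists>C\<in>\<C>. D \<subseteq> C))"

definition covering_number :: "nat \<Rightarrow> nat \<Rightarrow> nat" where
  "covering_number n r =
     (LEAST k. \<exists>\<C>. finite \<C> \<and> card \<C> = k \<and> (\<forall>C\<in>\<C>. chain_in_Bn n C) \<and> covers_chains n r \<C>)"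

(* The vector (a_0, ..., a_r) is a list of length r + 1; all entries are nonnegative by type. *)
definition gap_vectors :: "nat \<Rightarrow> nat \<Rightarrow> nat list set" where
  "gap_vectors n r =
     {a. length a = r + 1 \<and> (\<forall>i. 1 \<le> i \<and> i < r \<longrightarrow> 1 \<le> a ! i) \<and> sum_list a = n}"

definition multinomial :: "nat \<Rightarrow> nat list \<Rightarrow> real" where
  "multinomial n a = fact n / (\<Prod>i<length a. fact (a ! i))"

definition max_multinomial :: "nat \<Rightarrow> nat \<Rightarrow> real" where
  "max_multinomial n r = Max (multinomial n ` gap_vectors n r)"

end

theory Submission
  imports Defs "HOL-Combinatorics.Multiset_Permutations" "HOL-Library.Sublist"
begin

text \<open>
  View the problem as a set cover: the points are the strict chains of size \<open>r\<close>, and each of the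
  \<open>n!\<close> permutations of \<open>{1..n}\<close> covers those chains that consist of initial segments of it, i.e.
  that lie in the corresponding maximal chain (\<open>flag\<close>).  A maximal chain has \<open>n + 1\<close> members, so a
  permutation covers at most \<open>(n + 1) choose r\<close> points.  Conversely, a chain whose successive
  differences have sizes \<open>a\<^sub>0, \<dots>, a\<^sub>r\<close> lies in the maximal chains of at least \<open>a\<^sub>0! \<cdots> a\<^sub>r!\<close>
  permutations, obtained by ordering each difference separately (\<open>flags_through_chain\<close>).  That is
  the fraction \<open>1 / multinomial n a\<close> of all permutations, hence at least \<open>1 / M\<close>, where \<open>M\<close> is the
  maximal multinomial coefficient.  So giving every permutation the weight \<open>M / n!\<close> is a fractional
  cover of total weight \<open>M\<close>.

  The classical analysis of the greedy algorithm by Chvatal, Lovasz and Stein turns a fractional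
  cover into a genuine one at the cost of a factor \<open>harm q\<close>, where \<open>q\<close> bounds the number of points
  that one member covers (\<open>greedy_cover\<close>).  This is the first inequality; the second is
  \<open>harm q \<le> 1 + ln q\<close>.
\<close>

section \<open>Greedy set covers\<close>

lemma harm_diff_ge:
  assumes "k \<le> j" "j \<le> m"
  shows "(real j - real k) / real m \<le> harm j - harm k"
  using assms
proof (induction j rule: dec_induct)
  case (step j)
  have "1 / real m \<le> inverse (real (Suc j))"
    unfolding inverse_eq_divide using step by (intro divide_left_mono) auto
  then show ?case
    using step by (simp add: harm_Suc add_divide_distrib diff_divide_distrib)
qed simp

text \<open>The potential \<open>\<Sum>p\<in>P. harm (card (S p \<inter> U))\<close> of the uncovered points \<open>U\<close> pays for the greedy
  choices.  Let the next choice cover the set \<open>T\<close> of new points.  By maximality no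
  \<open>S p \<inter> U\<close> has more than \<open>card T\<close> elements, so each point of \<open>T\<close> that \<open>S p\<close> loses lowers its term by
  at least \<open>1 / card T\<close>.  Every point of \<open>T\<close> is lost by at least \<open>d\<close> members, so the whole potential
  falls by at least \<open>d\<close>.\<close>
lemma greedy_cover:
  fixes S :: "'p \<Rightarrow> 'x set" and d :: real
  assumes "finite P" "finite U" "d > 0"
    and "\<And>x. x \<in> U \<Longrightarrow> d \<le> real (card {p \<in> P. x \<in> S p})"
  shows "\<exists>Q\<subseteq>P. U \<subseteq> (\<Union>p\<in>Q. S p) \<and> d * real (card Q) \<le> (\<Sum>p\<in>P. harm (card (S p \<inter> U)))"
  using assms(2,4)
proof (induction U rule: finite_psubset_induct)
  case (psubset U)
  show ?case
  proof (cases "U = {}")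
    case True
    then show ?thesis by (intro exI[of _ "{}"]) (simp add: harm_nonneg sum_nonneg)
  next
    case False
    then obtain x where x: "x \<in> U" by blast
    have "0 < card {p \<in> P. x \<in> S p}"
      using psubset.prems[OF x] \<open>d > 0\<close> by linarith
    then obtain p where p: "p \<in> P" "x \<in> S p"
      by (auto simp: card_gt_0_iff)
    let ?m = "Max ((\<lambda>p. card (S p \<inter> U)) ` P)"
    have "?m \<in> (\<lambda>p. card (S p \<inter> U)) ` P"
      using p \<open>finite P\<close> by (intro Max_in) auto
    then obtain g where g: "g \<in> P" "?m = card (S g \<inter> U)" by blast
    define T where "T = S g \<inter> U"
    have max: "card (S p \<inter> U) \<le> card T" if "p \<in> P" for p
      using that \<open>finite P\<close> by (auto simp: T_def g(2)[symmetric])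
    have finT: "finite T" "T \<subseteq> U" using psubset.hyps by (auto simp: T_def)
    have "0 < card (S p \<inter> U)" using p x psubset.hyps by (auto simp: card_gt_0_iff)
    then have T_pos: "0 < card T" using max[OF p(1)] by linarith
    then have "U - T \<subset> U" using finT by (auto simp: card_gt_0_iff)
    from psubset.IH[OF this] psubset.prems obtain Q where
      Q: "Q \<subseteq> P" "U - T \<subseteq> (\<Union>p\<in>Q. S p)"
        "d * real (card Q) \<le> (\<Sum>p\<in>P. harm (card (S p \<inter> (U - T))))"
      by auto
    \<comment> \<open>Count the pairs of a point \<open>x \<in> T\<close> and a member \<open>p\<close> with \<open>x \<in> S p\<close> in two ways.\<close>
    have "d * real (card T) = (\<Sum>x\<in>T. d)" by simp
    also have "\<dots> \<le> (\<Sum>x\<in>T. real (card {p \<in> P. x \<in> S p}))"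
      using psubset.prems finT by (intro sum_mono) auto
    also have "\<dots> = (\<Sum>p\<in>P. real (card {x \<in> T. x \<in> S p}))"
      using sum.swap_restrict[OF finT(1) \<open>finite P\<close>, of "\<lambda>_ _. 1::real" "\<lambda>x p. x \<in> S p"]
      by simp
    finally have "d \<le> (\<Sum>p\<in>P. real (card {x \<in> T. x \<in> S p})) / real (card T)"
      using T_pos by (simp add: pos_le_divide_eq)
    also have "\<dots> = (\<Sum>p\<in>P. real (card {x \<in> T. x \<in> S p}) / real (card T))"
      by (rule sum_divide_distrib)
    also have "\<dots> \<le> (\<Sum>p\<in>P. harm (card (S p \<inter> U)) - harm (card (S p \<inter> (U - T))))"
    proof (intro sum_mono)
      fix p assume "p \<in> P"
      have fin: "finite (S p \<inter> U)" using psubset.hyps by blast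
      have "S p \<inter> (U - T) = (S p \<inter> U) - {x \<in> T. x \<in> S p}" by blast
      then have "card (S p \<inter> (U - T)) = card (S p \<inter> U) - card {x \<in> T. x \<in> S p}"
        using finT by (simp add: card_Diff_subset subset_iff)
      moreover have "card {x \<in> T. x \<in> S p} \<le> card (S p \<inter> U)"
        using finT by (intro card_mono fin) auto
      ultimately show "real (card {x \<in> T. x \<in> S p}) / real (card T)
          \<le> harm (card (S p \<inter> U)) - harm (card (S p \<inter> (U - T)))"
        using harm_diff_ge[of "card (S p \<inter> (U - T))" "card (S p \<inter> U)" "card T"] max[OF \<open>p \<in> P\<close>]
        by simp
    qed
    finally have step: "d \<le> (\<Sum>p\<in>P. harm (card (S p \<inter> U))) - (\<Sum>p\<in>P. harm (card (S p \<inter> (U - T))))"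
      by (simp add: sum_subtractf)
    have "real (card (insert g Q)) \<le> 1 + real (card Q)"
      using finite_subset[OF Q(1) \<open>finite P\<close>] by (simp add: card_insert_if)
    then have "d * real (card (insert g Q)) \<le> d * (1 + real (card Q))"
      using \<open>d > 0\<close> by (intro mult_left_mono) auto
    also have "\<dots> \<le> (\<Sum>p\<in>P. harm (card (S p \<inter> U)))"
      using step Q(3) by (simp add: distrib_left)
    finally show ?thesis
      using Q(1,2) g(1) by (intro exI[of _ "insert g Q"]) (auto simp: T_def)
  qed
qed

section \<open>Maximal chains as permutations\<close>

definition flag :: "'a list \<Rightarrow> 'a set set" where
  "flag xs = set ` set (prefixes xs)"

lemma chain_subset_flag: "chain_subset (flag xs)"
  unfolding chain_subset_def flag_def
proof clarsimp
  fix ys zs x y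
  assume "prefix ys xs" "prefix zs xs" "x \<in> set zs" "x \<notin> set ys" "y \<in> set ys"
  then show "y \<in> set zs"
    using prefix_same_cases[of ys xs zs] set_mono_prefix by blast
qed

lemma card_flag:
  assumes "distinct xs"
  shows "card (flag xs) = length xs + 1"
proof -
  have "inj_on set (set (prefixes xs))"
  proof (rule inj_onI)
    fix ys zs assume yz: "ys \<in> set (prefixes xs)" "zs \<in> set (prefixes xs)" "set ys = set zs"
    then have "distinct ys" "distinct zs"
      using assms by (metis in_set_prefixes prefixE distinct_append)+
    then have "length ys = length zs"
      using yz(3) by (metis distinct_card)
    then show "ys = zs" using yz(1,2) by (auto simp: prefix_def)
  qed
  then show ?thesis by (simp add: flag_def card_image)
qed

lemma flag_subset: "flag xs \<subseteq> Pow (set xs)"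
proof
  fix B assume "B \<in> flag xs"
  then obtain ys where "B = set ys" "prefix ys xs" by (auto simp: flag_def)
  then show "B \<in> Pow (set xs)" using set_mono_prefix[of ys xs] by simp
qed

lemma flag_append: "flag ys \<subseteq> flag (ys @ zs)" "set ys \<in> flag (ys @ zs)"
  by (auto simp: flag_def)

text \<open>The vector \<open>a\<close> lists the sizes of the successive differences of the chain, and concatenating
  permutations of these differences gives pairwise distinct permutations of \<open>A\<close> whose flags contain
  the chain.  The induction peels off the largest member \<open>F\<close> and applies the hypothesis to the rest
  of the chain inside \<open>F\<close>.  The last entry of the vector for \<open>F\<close> then becomes an interior one; the
  clause on \<open>a ! card D\<close> makes it positive, since \<open>F\<close> does not belong to the rest of the chain.\<close>
lemma flags_through_chain:
  fixes A :: "'a set"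
  assumes "finite A" "D \<subseteq> Pow A" "chain_subset D"
  shows "\<exists>a. length a = card D + 1 \<and> sum_list a = card A \<and>
    (\<forall>i. 1 \<le> i \<and> i < card D \<longrightarrow> 1 \<le> a ! i) \<and>
    (D \<noteq> {} \<and> A \<notin> D \<longrightarrow> 1 \<le> a ! card D) \<and>
    (\<Prod>k\<leftarrow>a. fact k) \<le> card {xs \<in> permutations_of_set A. D \<subseteq> flag xs}"
  using assms
proof (induction "card D" arbitrary: A D)
  case 0
  then have "D = {}" by (metis card_0_eq finite_Pow_iff finite_subset)
  then show ?case using 0 by (intro exI[of _ "[card A]"]) simp
next
  case (Suc r)
  have finD: "finite D" using Suc.prems by (metis finite_Pow_iff finite_subset)
  have "D \<noteq> {}" using Suc.hyps by auto
  then obtain F where F: "F \<in> D" and Fmax: "\<forall>G\<in>D. F \<subseteq> G \<longrightarrow> F = G"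
    using finite_has_maximal[OF finD] by blast
  have below: "G \<subseteq> F" if "G \<in> D" for G
    using that Fmax F Suc.prems(3) unfolding chain_subset_def by blast
  have FA: "F \<subseteq> A" using F Suc.prems by blast
  then have finF: "finite F" using Suc.prems(1) by (rule finite_subset)
  define D' where "D' = D - {F}"
  have r: "r = card D'" using Suc.hyps(2) F finD by (simp add: D'_def)
  have "D' \<subseteq> Pow F" "chain_subset D'" "F \<notin> D'"
    using below Suc.prems(3) by (auto simp: D'_def chain_subset_def)
  from Suc.hyps(1)[OF r finF this(1,2)] this(3) obtain a where
    a: "length a = r + 1" "sum_list a = card F" "\<forall>i. 1 \<le> i \<and> i < r \<longrightarrow> 1 \<le> a ! i"
      "D' \<noteq> {} \<longrightarrow> 1 \<le> a ! r"
      "(\<Prod>k\<leftarrow>a. fact k) \<le> card {xs \<in> permutations_of_set F. D' \<subseteq> flag xs}"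
    unfolding r by blast
  define b where "b = a @ [card A - card F]"
  let ?X = "{xs \<in> permutations_of_set F. D' \<subseteq> flag xs}"
  let ?Y = "permutations_of_set (A - F)"
  let ?Z = "{xs \<in> permutations_of_set A. D \<subseteq> flag xs}"
  have "inj_on (\<lambda>(ys, zs). ys @ zs) (?X \<times> ?Y)"
  proof (rule inj_onI, clarify)
    fix ys zs ys' zs'
    assume "ys \<in> permutations_of_set F" "ys' \<in> permutations_of_set F" "ys @ zs = ys' @ zs'"
    then show "ys = ys' \<and> zs = zs'"
      by (metis append_eq_append_conv length_finite_permutations_of_set)
  qed
  moreover have "(\<lambda>(ys, zs). ys @ zs) ` (?X \<times> ?Y) \<subseteq> ?Z"
  proof clarify
    fix ys zs
    assume ys: "ys \<in> permutations_of_set F" "D' \<subseteq> flag ys" and zs: "zs \<in> ?Y"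
    have "ys @ zs \<in> permutations_of_set A"
      using ys(1) zs FA by (auto simp: permutations_of_set_def)
    moreover have "D \<subseteq> flag (ys @ zs)"
      using flag_append[of ys zs] ys permutations_of_setD[OF ys(1)] by (auto simp: D'_def)
    ultimately show "ys @ zs \<in> permutations_of_set A \<and> D \<subseteq> flag (ys @ zs)" by blast
  qed
  ultimately have "card (?X \<times> ?Y) \<le> card ?Z"
    by (intro card_inj_on_le) auto
  moreover have "card ?Y = fact (card A - card F)"
    using Suc.prems FA finF by (simp add: card_Diff_subset)
  ultimately have "card ?X * fact (card A - card F) \<le> card ?Z"
    by (simp add: card_cartesian_product)
  then have count: "(\<Prod>k\<leftarrow>b. fact k) \<le> card ?Z"
    using order_trans[OF mult_right_mono[OF a(5), of "fact (card A - card F)"]]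
    by (simp add: b_def)
  have card_FA: "card F \<le> card A" using FA Suc.prems by (intro card_mono)
  have interior: "1 \<le> b ! i" if "1 \<le> i" "i < Suc r" for i
  proof (cases "i = r")
    case True
    then have "D' \<noteq> {}" using that r by auto
    then show ?thesis using a True by (simp add: b_def nth_append)
  qed (use that a in \<open>auto simp: b_def nth_append\<close>)
  have last: "1 \<le> b ! Suc r" if "A \<notin> D"
  proof -
    have "F \<subset> A" using FA F that by blast
    then have "card F < card A" using Suc.prems by (intro psubset_card_mono)
    then show ?thesis using a(1) by (simp add: b_def nth_append)
  qed
  show ?case
    using a(1,2) count interior last card_FA unfolding Suc.hyps(2)[symmetric]
    by (intro exI[of _ b]) (auto simp: b_def)
qed

section \<open>The maximal multinomial coefficient\<close>

lemma finite_gap_vectors: "finite (gap_vectors n r)"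
proof (rule finite_subset)
  show "gap_vectors n r \<subseteq> {a. set a \<subseteq> {..n} \<and> length a = r + 1}"
    by (auto simp: gap_vectors_def dest: member_le_sum_list)
qed (simp add: finite_lists_length_eq)

lemma gap_vectors_nonempty:
  assumes "1 \<le> r" "r \<le> n + 1"
  shows "gap_vectors n r \<noteq> {}"
proof -
  have "0 # replicate (r - 1) 1 @ [n + 1 - r] \<in> gap_vectors n r"
    using assms by (auto simp: gap_vectors_def nth_Cons nth_append sum_list_replicate split: nat.splits)
  then show ?thesis by blast
qed

lemma multinomial_alt: "multinomial n a = fact n / real (\<Prod>k\<leftarrow>a. fact k)"
proof -
  have "(\<Prod>k\<leftarrow>a. fact k) = (\<Prod>i<length a. fact (a ! i) :: nat)"
    by (simp add: prod.list_conv_set_nth atLeast0LessThan)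
  then show ?thesis by (simp add: multinomial_def)
qed

lemma multinomial_le_max:
  "a \<in> gap_vectors n r \<Longrightarrow> multinomial n a \<le> max_multinomial n r"
  unfolding max_multinomial_def using finite_gap_vectors by (intro Max_ge) auto

lemma multinomial_pos: "multinomial n a > 0"
  unfolding multinomial_def by (intro divide_pos_pos prod_pos) auto

section \<open>Covering chains by maximal chains\<close>

lemma harm_le_one_plus_ln:
  assumes "q > 0"
  shows "harm q \<le> 1 + ln (real q)"
  using euler_mascheroni_sequence_decreasing[of 1 q] assms by (simp add: harm_expand)

lemma flag_covering_family:
  assumes "d > 0"
    and deg: "\<And>D. chain_in_Bn n D \<Longrightarrow> card D = r \<Longrightarrow>
      d \<le> real (card {xs \<in> permutations_of_set {1..n}. D \<subseteq> flag xs})"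
  shows "\<exists>Q\<subseteq>permutations_of_set {1..n}. covers_chains n r (flag ` Q) \<and>
    d * real (card Q) \<le> fact n * harm ((n + 1) choose r)"
proof -
  let ?P = "permutations_of_set {1..n}"
  define U where "U = {D. chain_in_Bn n D \<and> card D = r}"
  define S where "S xs = {D. D \<subseteq> flag xs \<and> card D = r}" for xs :: "nat list"
  have "finite U" by (rule finite_subset[of _ "Pow (Pow {1..n})"]) (auto simp: U_def chain_in_Bn_def)
  moreover have "d \<le> real (card {xs \<in> ?P. D \<in> S xs})" if "D \<in> U" for D
    using that deg[of D] by (simp add: U_def S_def)
  ultimately obtain Q where Q: "Q \<subseteq> ?P" "U \<subseteq> (\<Union>xs\<in>Q. S xs)"
      "d * real (card Q) \<le> (\<Sum>xs\<in>?P. harm (card (S xs \<inter> U)))"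
    using greedy_cover[of ?P U d S] \<open>d > 0\<close> by auto
  have "(\<Sum>xs\<in>?P. harm (card (S xs \<inter> U))) \<le> (\<Sum>xs\<in>?P. harm ((n + 1) choose r) :: real)"
  proof (intro sum_mono harm_mono)
    fix xs assume "xs \<in> ?P"
    then have "card (flag xs) = n + 1"
      by (simp add: card_flag permutations_of_setD length_finite_permutations_of_set)
    moreover have "finite (flag xs)" by (simp add: flag_def)
    ultimately have "card (S xs) = (n + 1) choose r" "finite (S xs)"
      unfolding S_def using n_subsets[of "flag xs" r] by auto
    then show "card (S xs \<inter> U) \<le> (n + 1) choose r"
      by (metis card_mono inf_le1)
  qed
  then have "d * real (card Q) \<le> fact n * harm ((n + 1) choose r)"
    using Q(3) by simp
  moreover have "covers_chains n r (flag ` Q)"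
    using Q(2) by (auto simp: covers_chains_def U_def S_def)
  ultimately show ?thesis using Q(1) by blast
qed

theorem mainTheorem5:
  fixes n r :: nat
  assumes "n \<ge> 1" and "1 \<le> r" and "r \<le> n + 1"
  shows "real (covering_number n r) \<le> max_multinomial n r * harm ((n + 1) choose r)
       \<and> max_multinomial n r * harm ((n + 1) choose r)
           \<le> max_multinomial n r * (1 + ln (real ((n + 1) choose r)))"
proof
  let ?M = "max_multinomial n r"
  let ?q = "(n + 1) choose r"
  obtain a0 where "a0 \<in> gap_vectors n r" using gap_vectors_nonempty assms by blast
  then have M: "?M > 0" using multinomial_le_max multinomial_pos less_le_trans by blast
  have deg: "fact n / ?M \<le> real (card {xs \<in> permutations_of_set {1..n}. D \<subseteq> flag xs})"
    if chain: "chain_in_Bn n D" and cardD: "card D = r" for D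
  proof -
    have "D \<subseteq> Pow {1..n}" "chain_subset D" using chain by (auto simp: chain_in_Bn_def)
    from flags_through_chain[OF _ this] obtain a where
      "length a = r + 1" "sum_list a = n" "\<forall>i. 1 \<le> i \<and> i < r \<longrightarrow> 1 \<le> a ! i"
      and count: "(\<Prod>k\<leftarrow>a. fact k) \<le> card {xs \<in> permutations_of_set {1..n}. D \<subseteq> flag xs}"
      unfolding cardD card_atLeastAtMost by auto
    then have a: "a \<in> gap_vectors n r" by (simp add: gap_vectors_def)
    have "fact n / ?M \<le> fact n / multinomial n a"
      using multinomial_le_max[OF a] multinomial_pos M by (intro divide_left_mono) auto
    also have "\<dots> = real (\<Prod>k\<leftarrow>a. fact k)"
      by (simp add: multinomial_alt)
    finally show ?thesis using count by linarith
  qed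
  have "fact n / ?M > 0" using M by simp
  from flag_covering_family[OF this deg] obtain Q where
    Q: "Q \<subseteq> permutations_of_set {1..n}" "covers_chains n r (flag ` Q)"
      "fact n / ?M * real (card Q) \<le> fact n * harm ?q"
    by blast
  have finQ: "finite Q" using finite_subset[OF Q(1)] by simp
  have "\<forall>C\<in>flag ` Q. chain_in_Bn n C"
  proof clarify
    fix xs assume "xs \<in> Q"
    then have "set xs = {1..n}" using Q(1) permutations_of_setD by blast
    then show "chain_in_Bn n (flag xs)"
      using flag_subset[of xs] by (simp only: chain_in_Bn_def chain_subset_flag)
  qed
  then have "covering_number n r \<le> card (flag ` Q)"
    unfolding covering_number_def using Q(2) finQ by (intro Least_le exI[of _ "flag ` Q"]) simp
  also have "\<dots> \<le> card Q" by (rule card_image_le[OF finQ])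
  finally have "real (covering_number n r) \<le> real (card Q)" by simp
  also have "\<dots> \<le> ?M * harm ?q" using Q(3) M by (simp add: field_simps)
  finally show "real (covering_number n r) \<le> ?M * harm ?q" .
  show "?M * harm ?q \<le> ?M * (1 + ln (real ?q))"
    using M assms by (intro mult_left_mono harm_le_one_plus_ln) (auto simp: zero_less_binomial)
qed

end
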